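(* Let $(\mathfrak{g},[~,~]_\mathfrak{g},N)$ and $(\mathfrak{h},[~,~]_\mathfrak{h},S)$ be two Nijenhuis Lie algebras with deformed Lie algebras $\mathfrak{g}_N$ and $\mathfrak{h}_S$. For a non-abelian 2-cocycle $(\chi,\psi,F)$ of $(\mathfrak{g},[~,~]_\mathfrak{g},N)$ with values in $(\mathfrak{h},[~,~]_\mathfrak{h},S)$, define, for $x,y\in\mathfrak{g}$, $h\in\mathfrak{h}$, $$\overline{\chi}(x,y):=\chi(N(x),y)+\chi(x,N(y))-S\chi(x,y)+\psi_xF(y)-\psi_yF(x)-F[x,y]_\mathfrak{g},$$ $$\overline{\psi}_x(h):=\psi_{N(x)}h+\psi_xS(h)-S(\psi_xh)+[F(x),h]_\mathfrak{h}.$$ Then $(\overline{\chi},\overline{\psi})$ is a non-abelian 2-cocycle of the Lie algebra $\mathfrak{g}_N$ with values in the Lie algebra $\mathfrak{h}_S$. Moreover, if $(\chi,\psi,F)$ and $(\chi',\psi',F')$ are equivalent, then so are $(\overline{\chi},\overline{\psi})$ and $(\overline{\chi'},\overline{\psi'})$. Hence there is a well-defined map $$H^2_{nab}((\mathfrak{g},N);(\mathfrak{h},S))\to H^2_{nab}(\mathfrak{g}_N;\mathfrak{h}_S),\qquad[(\chi,\psi,F)]\mapsto[(\overline{\chi},\overline{\psi})].$$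
   Context: All vector spaces are over a fixed field. A Nijenhuis operator on a Lie algebra $(\mathfrak{g},[~,~]_\mathfrak{g})$ is a linear map $N:\mathfrak{g}\to\mathfrak{g}$ with $[N(x),N(y)]_\mathfrak{g}=N([N(x),y]_\mathfrak{g}+[x,N(y)]_\mathfrak{g}-N[x,y]_\mathfrak{g})$ for all $x,y\in\mathfrak{g}$. A Nijenhuis Lie algebra $(\mathfrak{g},[~,~]_\mathfrak{g},N)$ is a Lie algebra with a Nijenhuis operator $N$. Its deformed Lie algebra $\mathfrak{g}_N$ is the vector space $\mathfrak{g}$ with the Lie bracket $[x,y]_N:=[N(x),y]_\mathfrak{g}+[x,N(y)]_\mathfrak{g}-N[x,y]_\mathfrak{g}$ (it is well known that this is a Lie bracket); similarly $\mathfrak{h}_S=(\mathfrak{h},[~,~]_S)$. Non-abelian 2-cocycles (Nijenhuis case): a non-abelian 2-cocycle of $(\mathfrak{g},[~,~]_\mathfrak{g},N)$ with values in $(\mathfrak{h},[~,~]_\mathfrak{h},S)$ is a triple $(\chi,\psi,F)$ of linear maps $\chi:\wedge^2\mathfrak{g}\to\mathfrak{h}$, $\psi:\mathfrak{g}\to\mathrm{Der}(\mathfrak{h})$ ($x\mapsto\psi_x$), $F:\mathfrak{g}\to\mathfrak{h}$ such that for all $x,y,z\in\mathfrak{g}$, $h\in\mathfrak{h}$: (1) $\psi_x\psi_y(h)-\psi_y\psi_x(h)-\psi_{[x,y]_\mathfrak{g}}(h)=[\chi(x,y),h]_\mathfrak{h}$; (2) $\psi_x\chi(y,z)+\psi_y\chi(z,x)+\psi_z\chi(x,y)-\chi([x,y]_\mathfrak{g},z)-\chi([y,z]_\mathfrak{g},x)-\chi([z,x]_\mathfrak{g},y)=0$;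 (3) $\psi_{N(x)}S(h)=S(\psi_{N(x)}h+\psi_xS(h)-S(\psi_xh))+S[F(x),h]_\mathfrak{h}-[F(x),S(h)]_\mathfrak{h}$; (4) $\chi(N(x),N(y))-S(\chi(N(x),y)+\chi(x,N(y))-S(\chi(x,y)))-F([N(x),y]_\mathfrak{g}+[x,N(y)]_\mathfrak{g}-N[x,y]_\mathfrak{g})+\psi_{N(x)}F(y)-\psi_{N(y)}F(x)-S(\psi_xF(y)-\psi_yF(x)-F[x,y]_\mathfrak{g})+[F(x),F(y)]_\mathfrak{h}=0$. $(\chi,\psi,F)$ and $(\chi',\psi',F')$ are equivalent if there is a linear map $\varphi:\mathfrak{g}\to\mathfrak{h}$ such that for all $x,y\in\mathfrak{g}$, $h\in\mathfrak{h}$: (a) $\psi_xh-\psi'_xh=[\varphi(x),h]_\mathfrak{h}$; (b) $\chi(x,y)-\chi'(x,y)=\psi'_x(\varphi(y))-\psi'_y(\varphi(x))-\varphi([x,y]_\mathfrak{g})+[\varphi(x),\varphi(y)]_\mathfrak{h}$; (c) $F(x)-F'(x)=S(\varphi(x))-\varphi(N(x))$. $H^2_{nab}((\mathfrak{g},N);(\mathfrak{h},S))$ is the set of equivalence classes. Lie algebra case: for Lie algebras $\mathfrak{g},\mathfrak{h}$, a non-abelian 2-cocycle of $\mathfrak{g}$ with values in $\mathfrak{h}$ is a pair $(\chi,\psi)$ of linear maps $\chi:\wedge^2\mathfrak{g}\to\mathfrak{h}$, $\psi:\mathfrak{g}\to\mathrm{Der}(\mathfrak{h})$ satisfying (1)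 and (2) for the given Lie brackets; two such pairs are equivalent if there is a linear map $\varphi:\mathfrak{g}\to\mathfrak{h}$ satisfying (a) and (b); $H^2_{nab}(\mathfrak{g};\mathfrak{h})$ is the set of equivalence classes. For $\mathfrak{g}_N$ and $\mathfrak{h}_S$ the brackets used are $[~,~]_N$ and $[~,~]_S$. *)

theory Defs
  imports Complex_Main "HOL-Library.FuncSet"
begin

section \<open>Lie algebras and Nijenhuis operators\<close>

text \<open>
  A vector space over a field is a type of class \<open>ab_group_add\<close> together with a scalar
  multiplication satisfying \<^locale>\<open>vector_space\<close>. The field is arbitrary (any characteristic),
  no dimension is assumed finite, and \<open>alternating\<close> means \<open>B x x = 0\<close>; so a linear map
  on the second exterior power is an alternating bilinear map.
\<close>

definition bilinear_map ::
  "('k::field \<Rightarrow> 'a::ab_group_add \<Rightarrow> 'a) \<Rightarrow> ('k \<Rightarrow> 'b::ab_group_add \<Rightarrow> 'b) \<Rightarrow>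
   ('k \<Rightarrow> 'c::ab_group_add \<Rightarrow> 'c) \<Rightarrow> ('a \<Rightarrow> 'b \<Rightarrow> 'c) \<Rightarrow> bool"
  where "bilinear_map s1 s2 s3 B \<longleftrightarrow>
    (\<forall>x. Vector_Spaces.linear s2 s3 (\<lambda>y. B x y)) \<and>
    (\<forall>y. Vector_Spaces.linear s1 s3 (\<lambda>x. B x y))"

definition alternating_map ::
  "('k::field \<Rightarrow> 'a::ab_group_add \<Rightarrow> 'a) \<Rightarrow> ('k \<Rightarrow> 'b::ab_group_add \<Rightarrow> 'b) \<Rightarrow>
   ('a \<Rightarrow> 'a \<Rightarrow> 'b) \<Rightarrow> bool"
  where "alternating_map s1 s2 B \<longleftrightarrow> bilinear_map s1 s1 s2 B \<and> (\<forall>x. B x x = 0)"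

locale lie_algebra = vector_space scale
  for scale :: "'k::field \<Rightarrow> 'a::ab_group_add \<Rightarrow> 'a" +
  fixes bracket :: "'a \<Rightarrow> 'a \<Rightarrow> 'a"
  assumes alternating_bracket: "alternating_map scale scale bracket"
    and jacobi: "bracket x (bracket y z) + bracket y (bracket z x) + bracket z (bracket x y) = 0"

definition deformed_bracket :: "('a::ab_group_add \<Rightarrow> 'a \<Rightarrow> 'a) \<Rightarrow> ('a \<Rightarrow> 'a) \<Rightarrow> 'a \<Rightarrow> 'a \<Rightarrow> 'a"
  where "deformed_bracket br N x y = br (N x) y + br x (N y) - N (br x y)"

locale nijenhuis_lie_algebra = lie_algebra scale bracket
  for scale :: "'k::field \<Rightarrow> 'a::ab_group_add \<Rightarrow> 'a" and bracket :: "'a \<Rightarrow> 'a \<Rightarrow> 'a" +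
  fixes N :: "'a \<Rightarrow> 'a"
  assumes linear_N: "Vector_Spaces.linear scale scale N"
    and nijenhuis: "bracket (N x) (N y) =
      N (bracket (N x) y + bracket x (N y) - N (bracket x y))"

definition lie_derivation ::
  "('k::field \<Rightarrow> 'a::ab_group_add \<Rightarrow> 'a) \<Rightarrow> ('a \<Rightarrow> 'a \<Rightarrow> 'a) \<Rightarrow> ('a \<Rightarrow> 'a) \<Rightarrow> bool"
  where "lie_derivation s br D \<longleftrightarrow> Vector_Spaces.linear s s D \<and>
    (\<forall>h k. D (br h k) = br (D h) k + br h (D k))"

section \<open>Non-abelian 2-cocycles of Lie algebras\<close>

text \<open>
  The suffixes \<open>g\<close> and \<open>h\<close> refer to the two Lie algebras. Linearity of a map into the
  derivations of \<open>h\<close> is pointwise linearity, hence \<open>\<psi>\<close> is bilinear as a curried map.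
\<close>

definition lie_cocycle ::
  "('k::field \<Rightarrow> 'g::ab_group_add \<Rightarrow> 'g) \<Rightarrow> ('g \<Rightarrow> 'g \<Rightarrow> 'g) \<Rightarrow>
   ('k \<Rightarrow> 'h::ab_group_add \<Rightarrow> 'h) \<Rightarrow> ('h \<Rightarrow> 'h \<Rightarrow> 'h) \<Rightarrow>
   ('g \<Rightarrow> 'g \<Rightarrow> 'h) \<times> ('g \<Rightarrow> 'h \<Rightarrow> 'h) \<Rightarrow> bool"
  where "lie_cocycle sg brg sh brh = (\<lambda>(\<chi>, \<psi>).
    alternating_map sg sh \<chi> \<and>
    bilinear_map sg sh sh \<psi> \<and>
    (\<forall>x. lie_derivation sh brh (\<psi> x)) \<and>
    (\<forall>x y h. \<psi> x (\<psi> y h) - \<psi> y (\<psi> x h) - \<psi> (brg x y) h = brh (\<chi> x y) h) \<and>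
    (\<forall>x y z. \<psi> x (\<chi> y z) + \<psi> y (\<chi> z x) + \<psi> z (\<chi> x y)
      - \<chi> (brg x y) z - \<chi> (brg y z) x - \<chi> (brg z x) y = 0))"

definition lie_equiv_via ::
  "('k::field \<Rightarrow> 'g::ab_group_add \<Rightarrow> 'g) \<Rightarrow> ('g \<Rightarrow> 'g \<Rightarrow> 'g) \<Rightarrow>
   ('k \<Rightarrow> 'h::ab_group_add \<Rightarrow> 'h) \<Rightarrow> ('h \<Rightarrow> 'h \<Rightarrow> 'h) \<Rightarrow> ('g \<Rightarrow> 'h) \<Rightarrow>
   ('g \<Rightarrow> 'g \<Rightarrow> 'h) \<times> ('g \<Rightarrow> 'h \<Rightarrow> 'h) \<Rightarrow>
   ('g \<Rightarrow> 'g \<Rightarrow> 'h) \<times> ('g \<Rightarrow> 'h \<Rightarrow> 'h) \<Rightarrow> bool"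
  where "lie_equiv_via sg brg sh brh \<phi> = (\<lambda>(\<chi>, \<psi>) (\<chi>', \<psi>').
    Vector_Spaces.linear sg sh \<phi> \<and>
    (\<forall>x h. \<psi> x h - \<psi>' x h = brh (\<phi> x) h) \<and>
    (\<forall>x y. \<chi> x y - \<chi>' x y =
      \<psi>' x (\<phi> y) - \<psi>' y (\<phi> x) - \<phi> (brg x y) + brh (\<phi> x) (\<phi> y)))"

definition lie_cocycles where
  "lie_cocycles sg brg sh brh = {c. lie_cocycle sg brg sh brh c}"

definition lie_cocycle_rel where
  "lie_cocycle_rel sg brg sh brh = {(c, c').
    c \<in> lie_cocycles sg brg sh brh \<and> c' \<in> lie_cocycles sg brg sh brh \<and>
    (\<exists>\<phi>. lie_equiv_via sg brg sh brh \<phi> c c')}"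

definition lie_H2_nab where
  "lie_H2_nab sg brg sh brh = lie_cocycles sg brg sh brh // lie_cocycle_rel sg brg sh brh"

section \<open>Non-abelian 2-cocycles of Nijenhuis Lie algebras\<close>

definition nij_cocycle ::
  "('k::field \<Rightarrow> 'g::ab_group_add \<Rightarrow> 'g) \<Rightarrow> ('g \<Rightarrow> 'g \<Rightarrow> 'g) \<Rightarrow> ('g \<Rightarrow> 'g) \<Rightarrow>
   ('k \<Rightarrow> 'h::ab_group_add \<Rightarrow> 'h) \<Rightarrow> ('h \<Rightarrow> 'h \<Rightarrow> 'h) \<Rightarrow> ('h \<Rightarrow> 'h) \<Rightarrow>
   ('g \<Rightarrow> 'g \<Rightarrow> 'h) \<times> ('g \<Rightarrow> 'h \<Rightarrow> 'h) \<times> ('g \<Rightarrow> 'h) \<Rightarrow> bool"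
  where "nij_cocycle sg brg N sh brh S = (\<lambda>(\<chi>, \<psi>, F).
    lie_cocycle sg brg sh brh (\<chi>, \<psi>) \<and>
    Vector_Spaces.linear sg sh F \<and>
    (\<forall>x h. \<psi> (N x) (S h) =
      S (\<psi> (N x) h + \<psi> x (S h) - S (\<psi> x h)) + S (brh (F x) h) - brh (F x) (S h)) \<and>
    (\<forall>x y. \<chi> (N x) (N y) - S (\<chi> (N x) y + \<chi> x (N y) - S (\<chi> x y))
      - F (brg (N x) y + brg x (N y) - N (brg x y))
      + \<psi> (N x) (F y) - \<psi> (N y) (F x)
      - S (\<psi> x (F y) - \<psi> y (F x) - F (brg x y)) + brh (F x) (F y) = 0))"

definition nij_equiv_via ::
  "('k::field \<Rightarrow> 'g::ab_group_add \<Rightarrow> 'g) \<Rightarrow> ('g \<Rightarrow> 'g \<Rightarrow> 'g) \<Rightarrow> ('g \<Rightarrow> 'g) \<Rightarrow>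
   ('k \<Rightarrow> 'h::ab_group_add \<Rightarrow> 'h) \<Rightarrow> ('h \<Rightarrow> 'h \<Rightarrow> 'h) \<Rightarrow> ('h \<Rightarrow> 'h) \<Rightarrow> ('g \<Rightarrow> 'h) \<Rightarrow>
   ('g \<Rightarrow> 'g \<Rightarrow> 'h) \<times> ('g \<Rightarrow> 'h \<Rightarrow> 'h) \<times> ('g \<Rightarrow> 'h) \<Rightarrow>
   ('g \<Rightarrow> 'g \<Rightarrow> 'h) \<times> ('g \<Rightarrow> 'h \<Rightarrow> 'h) \<times> ('g \<Rightarrow> 'h) \<Rightarrow> bool"
  where "nij_equiv_via sg brg N sh brh S \<phi> = (\<lambda>(\<chi>, \<psi>, F) (\<chi>', \<psi>', F').
    lie_equiv_via sg brg sh brh \<phi> (\<chi>, \<psi>) (\<chi>', \<psi>') \<and>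
    (\<forall>x. F x - F' x = S (\<phi> x) - \<phi> (N x)))"

definition nij_cocycles where
  "nij_cocycles sg brg N sh brh S = {c. nij_cocycle sg brg N sh brh S c}"

definition nij_cocycle_rel where
  "nij_cocycle_rel sg brg N sh brh S = {(c, c').
    c \<in> nij_cocycles sg brg N sh brh S \<and> c' \<in> nij_cocycles sg brg N sh brh S \<and>
    (\<exists>\<phi>. nij_equiv_via sg brg N sh brh S \<phi> c c')}"

definition nij_H2_nab where
  "nij_H2_nab sg brg N sh brh S =
    nij_cocycles sg brg N sh brh S // nij_cocycle_rel sg brg N sh brh S"

section \<open>The deformed cocycle\<close>

definition deformed_cocycle ::
  "('g::ab_group_add \<Rightarrow> 'g \<Rightarrow> 'g) \<Rightarrow> ('g \<Rightarrow> 'g) \<Rightarrow>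
   ('h::ab_group_add \<Rightarrow> 'h \<Rightarrow> 'h) \<Rightarrow> ('h \<Rightarrow> 'h) \<Rightarrow>
   ('g \<Rightarrow> 'g \<Rightarrow> 'h) \<times> ('g \<Rightarrow> 'h \<Rightarrow> 'h) \<times> ('g \<Rightarrow> 'h) \<Rightarrow>
   ('g \<Rightarrow> 'g \<Rightarrow> 'h) \<times> ('g \<Rightarrow> 'h \<Rightarrow> 'h)"
  where "deformed_cocycle brg N brh S = (\<lambda>(\<chi>, \<psi>, F).
    (\<lambda>x y. \<chi> (N x) y + \<chi> x (N y) - S (\<chi> x y) + \<psi> x (F y) - \<psi> y (F x) - F (brg x y),
     \<lambda>x h. \<psi> (N x) h + \<psi> x (S h) - S (\<psi> x h) + brh (F x) h))"

section \<open>The notions above are well-formed\<close>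

text \<open>
  The deformed bracket is a Lie bracket, and the two relations are equivalence relations on
  cocycles, so \<open>lie_H2_nab\<close> and \<open>nij_H2_nab\<close> are indeed sets of equivalence classes.
\<close>

lemma linear_mapD:
  assumes "Vector_Spaces.linear s1 s2 f"
  shows "f (x + y) = f x + f y" "f (x - y) = f x - f y" "f (- x) = - f x" "f 0 = 0"
    "f (s1 c x) = s2 c (f x)"
proof -
  interpret Vector_Spaces.linear s1 s2 f by fact
  show "f (x + y) = f x + f y" "f (x - y) = f x - f y" "f (- x) = - f x" "f 0 = 0"
    "f (s1 c x) = s2 c (f x)"
    by (simp_all add: add diff neg zero scale)
qed

lemma bilinear_mapD:
  assumes "bilinear_map s1 s2 s3 B"
  shows "B (x + x') y = B x y + B x' y" "B (x - x') y = B x y - B x' y"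
    "B (- x) y = - B x y" "B 0 y = 0" "B (s1 c x) y = s3 c (B x y)"
    "B x (y + y') = B x y + B x y'" "B x (y - y') = B x y - B x y'"
    "B x (- y) = - B x y" "B x 0 = 0" "B x (s2 c y) = s3 c (B x y)"
proof -
  have 1: "Vector_Spaces.linear s1 s3 (\<lambda>x. B x y)" for y
    using assms by (simp add: bilinear_map_def)
  have 2: "Vector_Spaces.linear s2 s3 (\<lambda>y. B x y)" for x
    using assms by (simp add: bilinear_map_def)
  show "B (x + x') y = B x y + B x' y" "B (x - x') y = B x y - B x' y"
    "B (- x) y = - B x y" "B 0 y = 0" "B (s1 c x) y = s3 c (B x y)"
    using linear_mapD[OF 1] by blast+
  show "B x (y + y') = B x y + B x y'" "B x (y - y') = B x y - B x y'"
    "B x (- y) = - B x y" "B x 0 = 0" "B x (s2 c y) = s3 c (B x y)"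
    using linear_mapD[OF 2] by blast+
qed

lemma linear_mapI:
  assumes "vector_space s1" "vector_space s2"
    "\<And>x y. f (x + y) = f x + f y" "\<And>c x. f (s1 c x) = s2 c (f x)"
  shows "Vector_Spaces.linear s1 s2 f"
proof -
  interpret vs1: vector_space s1 by fact
  interpret vs2: vector_space s2 by fact
  show ?thesis by unfold_locales (use assms in auto)
qed

context lie_algebra
begin

lemma bilinear_bracket: "bilinear_map scale scale scale bracket"
  using alternating_bracket by (simp add: alternating_map_def)

lemmas bracket_simps = bilinear_mapD[OF bilinear_bracket]

lemma bracket_self: "bracket x x = 0"
  using alternating_bracket by (simp add: alternating_map_def)

lemma bracket_anticomm: "bracket x y = - bracket y x"
proof -
  have "0 = bracket (x + y) (x + y)"
    by (rule bracket_self[symmetric])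
  also have "\<dots> = bracket x x + bracket x y + (bracket y x + bracket y y)"
    by (simp only: bracket_simps ac_simps)
  finally have "bracket x y + bracket y x = 0"
    by (simp add: bracket_self)
  then show ?thesis
    by (simp add: eq_neg_iff_add_eq_0)
qed

end

context nijenhuis_lie_algebra
begin

lemmas N_simps = linear_mapD[OF linear_N]

lemma vector_space_scale: "vector_space scale"
  by unfold_locales

theorem lie_algebra_deformed: "lie_algebra scale (deformed_bracket bracket N)"
proof -
  let ?d = "deformed_bracket bracket N"
  have bil: "bilinear_map scale scale scale ?d"
    unfolding bilinear_map_def deformed_bracket_def
    by (auto intro!: linear_mapI vector_space_scale
        simp: bracket_simps N_simps algebra_simps)
  have alt: "?d x x = 0" for x
    using bracket_anticomm[of "N x" x]
    by (simp add: deformed_bracket_def bracket_self N_simps)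
  have N_d: "N (?d x y) = bracket (N x) (N y)" for x y
    by (simp add: deformed_bracket_def nijenhuis)
  have expand: "?d x (?d y z) =
      bracket (N x) (bracket (N y) z) + bracket (N x) (bracket y (N z)) + bracket x (bracket (N y) (N z))
      - N (bracket (N x) (bracket y z) + bracket x (bracket (N y) z) + bracket x (bracket y (N z)))
      + N (N (bracket x (bracket y z)))" for x y z
  proof -
    have "?d x (?d y z) = bracket (N x) (?d y z) + bracket x (N (?d y z)) - N (bracket x (?d y z))"
      by (simp add: deformed_bracket_def[of _ _ x])
    also have "bracket x (N (?d y z)) = bracket x (bracket (N y) (N z))"
      by (simp add: N_d)
    also have "bracket (N x) (?d y z) = bracket (N x) (bracket (N y) z)
        + bracket (N x) (bracket y (N z)) - bracket (N x) (N (bracket y z))"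
      by (simp add: deformed_bracket_def bracket_simps)
    also have "bracket (N x) (N (bracket y z)) = N (bracket (N x) (bracket y z))
        + N (bracket x (N (bracket y z))) - N (N (bracket x (bracket y z)))"
      by (simp add: nijenhuis N_simps)
    also have "N (bracket x (?d y z)) = N (bracket x (bracket (N y) z))
        + N (bracket x (bracket y (N z))) - N (bracket x (N (bracket y z)))"
      by (simp add: deformed_bracket_def bracket_simps N_simps)
    finally show ?thesis
      by (simp add: N_simps algebra_simps)
  qed
  have jac: "bracket z (bracket x y) = - bracket x (bracket y z) - bracket y (bracket z x)" for x y z
    using jacobi[of x y z] by (simp add: algebra_simps eq_neg_iff_add_eq_0)
  have "?d x (?d y z) + ?d y (?d z x) + ?d z (?d x y) = 0" for x y z
    unfolding expand
    by (simp add: jac[of z x y] jac[of z "N x" y] jac[of z x "N y"] jac[of "N z" x y]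
        jac[of z "N x" "N y"] jac[of "N z" "N x" y] jac[of "N z" x "N y"]
        N_simps algebra_simps)
  with bil alt show ?thesis
    by (intro lie_algebra.intro lie_algebra_axioms.intro vector_space_scale)
      (auto simp: alternating_map_def)
qed

end

context
  fixes sg :: "'k::field \<Rightarrow> 'g::ab_group_add \<Rightarrow> 'g" and brg :: "'g \<Rightarrow> 'g \<Rightarrow> 'g"
    and sh :: "'k \<Rightarrow> 'h::ab_group_add \<Rightarrow> 'h" and brh :: "'h \<Rightarrow> 'h \<Rightarrow> 'h"
  assumes G: "lie_algebra sg brg" and H: "lie_algebra sh brh"
begin

interpretation G: lie_algebra sg brg by (rule G)
interpretation H: lie_algebra sh brh by (rule H)

lemma vs_gh: "vector_space sg" "vector_space sh"
  by unfold_locales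

lemma lie_equiv_via_refl:
  assumes "lie_cocycle sg brg sh brh c"
  shows "lie_equiv_via sg brg sh brh (\<lambda>x. 0) c c"
proof -
  obtain \<chi> \<psi> where c: "c = (\<chi>, \<psi>)" by (cases c)
  have "bilinear_map sg sh sh \<psi>"
    using assms by (simp add: c lie_cocycle_def)
  from bilinear_mapD[OF this] show ?thesis
    by (auto simp: c lie_equiv_via_def H.bracket_simps intro!: linear_mapI vs_gh)
qed

lemma lie_equiv_via_sym:
  assumes "lie_equiv_via sg brg sh brh \<phi> c c'" and "lie_cocycle sg brg sh brh c"
  shows "lie_equiv_via sg brg sh brh (\<lambda>x. - \<phi> x) c' c"
proof -
  obtain \<chi> \<psi> \<chi>' \<psi>' where c: "c = (\<chi>, \<psi>)" "c' = (\<chi>', \<psi>')" by (cases c, cases c')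
  have lin: "Vector_Spaces.linear sg sh \<phi>"
    and a: "\<psi> x h - \<psi>' x h = brh (\<phi> x) h"
    and b: "\<chi> x y - \<chi>' x y = \<psi>' x (\<phi> y) - \<psi>' y (\<phi> x) - \<phi> (brg x y) + brh (\<phi> x) (\<phi> y)" for x y h
    using assms(1) by (auto simp: c lie_equiv_via_def)
  have \<psi>: "bilinear_map sg sh sh \<psi>"
    using assms(2) by (simp add: c lie_cocycle_def)
  have a': "\<psi>' x h = \<psi> x h - brh (\<phi> x) h" for x h
    using a[of x h] by (simp add: algebra_simps)
  have b': "\<chi> x y = \<chi>' x y + \<psi>' x (\<phi> y) - \<psi>' y (\<phi> x) - \<phi> (brg x y) + brh (\<phi> x) (\<phi> y)" for x y
    using b[of x y] by (simp add: algebra_simps)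
  have "\<chi>' x y - \<chi> x y = \<psi> x (- \<phi> y) - \<psi> y (- \<phi> x) - (- \<phi> (brg x y)) + brh (- \<phi> x) (- \<phi> y)" for x y
    using H.bracket_anticomm[of "\<phi> y" "\<phi> x"]
    by (simp add: b' bilinear_mapD[OF \<psi>] H.bracket_simps a' algebra_simps)
  moreover have "Vector_Spaces.linear sg sh (\<lambda>x. - \<phi> x)"
    by (intro linear_mapI vs_gh) (simp_all add: linear_mapD[OF lin] H.scale_minus_right)
  ultimately show ?thesis
    by (simp add: c lie_equiv_via_def a' H.bracket_simps)
qed

lemma lie_equiv_via_trans:
  assumes "lie_equiv_via sg brg sh brh \<phi> c c'" "lie_equiv_via sg brg sh brh \<phi>' c' c''"
    and "lie_cocycle sg brg sh brh c''"
  shows "lie_equiv_via sg brg sh brh (\<lambda>x. \<phi> x + \<phi>' x) c c''"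
proof -
  obtain \<chi> \<psi> \<chi>' \<psi>' \<chi>'' \<psi>'' where c: "c = (\<chi>, \<psi>)" "c' = (\<chi>', \<psi>')" "c'' = (\<chi>'', \<psi>'')"
    by (cases c, cases c', cases c'')
  have lin: "Vector_Spaces.linear sg sh \<phi>"
    and a: "\<psi> x h - \<psi>' x h = brh (\<phi> x) h"
    and b: "\<chi> x y - \<chi>' x y = \<psi>' x (\<phi> y) - \<psi>' y (\<phi> x) - \<phi> (brg x y) + brh (\<phi> x) (\<phi> y)" for x y h
    using assms(1) by (auto simp: c lie_equiv_via_def)
  have lin': "Vector_Spaces.linear sg sh \<phi>'"
    and a': "\<psi>' x h - \<psi>'' x h = brh (\<phi>' x) h"
    and b': "\<chi>' x y - \<chi>'' x y = \<psi>'' x (\<phi>' y) - \<psi>'' y (\<phi>' x) - \<phi>' (brg x y) + brh (\<phi>' x) (\<phi>' y)" for x y h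
    using assms(2) by (auto simp: c lie_equiv_via_def)
  have \<psi>'': "bilinear_map sg sh sh \<psi>''"
    using assms(3) by (simp add: c lie_cocycle_def)
  have A: "\<psi> x h = \<psi>' x h + brh (\<phi> x) h" for x h
    using a[of x h] by (simp add: algebra_simps)
  have A': "\<psi>' x h = \<psi>'' x h + brh (\<phi>' x) h" for x h
    using a'[of x h] by (simp add: algebra_simps)
  have B: "\<chi> x y = \<chi>' x y + \<psi>' x (\<phi> y) - \<psi>' y (\<phi> x) - \<phi> (brg x y) + brh (\<phi> x) (\<phi> y)" for x y
    using b[of x y] by (simp add: algebra_simps)
  have B': "\<chi>' x y = \<chi>'' x y + \<psi>'' x (\<phi>' y) - \<psi>'' y (\<phi>' x) - \<phi>' (brg x y) + brh (\<phi>' x) (\<phi>' y)" for x y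
    using b'[of x y] by (simp add: algebra_simps)
  have "\<chi> x y - \<chi>'' x y = \<psi>'' x (\<phi> y + \<phi>' y) - \<psi>'' y (\<phi> x + \<phi>' x)
      - (\<phi> (brg x y) + \<phi>' (brg x y)) + brh (\<phi> x + \<phi>' x) (\<phi> y + \<phi>' y)" for x y
    using H.bracket_anticomm[of "\<phi>' y" "\<phi> x"]
    by (simp add: B B' A' bilinear_mapD[OF \<psi>''] H.bracket_simps algebra_simps)
  moreover have "Vector_Spaces.linear sg sh (\<lambda>x. \<phi> x + \<phi>' x)"
    by (intro linear_mapI vs_gh)
      (simp_all add: linear_mapD[OF lin] linear_mapD[OF lin'] H.scale_right_distrib algebra_simps)
  ultimately show ?thesis
    by (simp add: c lie_equiv_via_def A A' H.bracket_simps)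
qed

theorem equiv_lie_cocycle_rel:
  "equiv (lie_cocycles sg brg sh brh) (lie_cocycle_rel sg brg sh brh)"
proof (rule equivI)
  show "lie_cocycle_rel sg brg sh brh \<subseteq> lie_cocycles sg brg sh brh \<times> lie_cocycles sg brg sh brh"
    by (auto simp: lie_cocycle_rel_def)
  show "refl_on (lie_cocycles sg brg sh brh) (lie_cocycle_rel sg brg sh brh)"
    unfolding refl_on_def lie_cocycle_rel_def lie_cocycles_def
    by (blast intro: lie_equiv_via_refl)
  show "sym (lie_cocycle_rel sg brg sh brh)"
    unfolding sym_def lie_cocycle_rel_def lie_cocycles_def
    by (blast intro: lie_equiv_via_sym)
  show "trans (lie_cocycle_rel sg brg sh brh)"
    unfolding trans_def lie_cocycle_rel_def lie_cocycles_def
    by (blast intro: lie_equiv_via_trans)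
qed

theorem equiv_nij_cocycle_rel:
  assumes N: "Vector_Spaces.linear sg sg N" and S: "Vector_Spaces.linear sh sh S"
  shows "equiv (nij_cocycles sg brg N sh brh S) (nij_cocycle_rel sg brg N sh brh S)"
proof (rule equivI)
  let ?Z = "nij_cocycles sg brg N sh brh S" and ?R = "nij_cocycle_rel sg brg N sh brh S"
  note S' = linear_mapD[OF S]
  have coc: "lie_cocycle sg brg sh brh (\<chi>, \<psi>)" if "(\<chi>, \<psi>, F) \<in> ?Z" for \<chi> \<psi> F
    using that by (simp add: nij_cocycles_def nij_cocycle_def)
  show "?R \<subseteq> ?Z \<times> ?Z"
    by (auto simp: nij_cocycle_rel_def)
  show "refl_on ?Z ?R"
  proof (rule refl_onI)
    fix c assume c: "c \<in> ?Z"
    obtain \<chi> \<psi> F where c': "c = (\<chi>, \<psi>, F)" by (cases c)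
    have "nij_equiv_via sg brg N sh brh S (\<lambda>x. 0) c c"
      using lie_equiv_via_refl[OF coc[OF c[unfolded c']]] by (simp add: c' nij_equiv_via_def S')
    with c show "(c, c) \<in> ?R" by (auto simp: nij_cocycle_rel_def)
  qed
  show "sym ?R"
  proof (rule symI)
    fix c c' assume R: "(c, c') \<in> ?R"
    obtain \<chi> \<psi> F \<chi>' \<psi>' F' where c: "c = (\<chi>, \<psi>, F)" "c' = (\<chi>', \<psi>', F')"
      by (cases c, cases c')
    from R obtain \<phi> where Z: "c \<in> ?Z" "c' \<in> ?Z"
      and \<phi>: "lie_equiv_via sg brg sh brh \<phi> (\<chi>, \<psi>) (\<chi>', \<psi>')"
      and F: "\<And>x. F x - F' x = S (\<phi> x) - \<phi> (N x)"
      by (auto simp: nij_cocycle_rel_def nij_equiv_via_def c)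
    have F': "F' x - F x = S (- \<phi> x) - (- \<phi> (N x))" for x
      using arg_cong[OF F[of x], of uminus] by (simp add: S')
    have "nij_equiv_via sg brg N sh brh S (\<lambda>x. - \<phi> x) c' c"
      using lie_equiv_via_sym[OF \<phi> coc[OF Z(1)[unfolded c]]] F' by (simp add: c nij_equiv_via_def)
    with Z show "(c', c) \<in> ?R" by (auto simp: nij_cocycle_rel_def)
  qed
  show "trans ?R"
  proof (rule transI)
    fix c c' c'' assume R: "(c, c') \<in> ?R" "(c', c'') \<in> ?R"
    obtain \<chi> \<psi> F \<chi>' \<psi>' F' \<chi>'' \<psi>'' F'' where
      c: "c = (\<chi>, \<psi>, F)" "c' = (\<chi>', \<psi>', F')" "c'' = (\<chi>'', \<psi>'', F'')"
      by (cases c, cases c', cases c'')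
    from R(1) obtain \<phi> where Z: "c \<in> ?Z"
      and \<phi>: "lie_equiv_via sg brg sh brh \<phi> (\<chi>, \<psi>) (\<chi>', \<psi>')"
      and F: "\<And>x. F x - F' x = S (\<phi> x) - \<phi> (N x)"
      by (auto simp: nij_cocycle_rel_def nij_equiv_via_def c)
    from R(2) obtain \<phi>' where Z'': "c'' \<in> ?Z"
      and \<phi>': "lie_equiv_via sg brg sh brh \<phi>' (\<chi>', \<psi>') (\<chi>'', \<psi>'')"
      and F': "\<And>x. F' x - F'' x = S (\<phi>' x) - \<phi>' (N x)"
      by (auto simp: nij_cocycle_rel_def nij_equiv_via_def c)
    have "F x - F'' x = S (\<phi> x + \<phi>' x) - (\<phi> (N x) + \<phi>' (N x))" for x
      using arg_cong2[OF F[of x] F'[of x], of "(+)"] by (simp add: S' algebra_simps)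
    then have "nij_equiv_via sg brg N sh brh S (\<lambda>x. \<phi> x + \<phi>' x) c c''"
      using lie_equiv_via_trans[OF \<phi> \<phi>' coc[OF Z''[unfolded c]]] by (simp add: c nij_equiv_via_def)
    with Z Z'' show "(c, c'') \<in> ?R" by (auto simp: nij_cocycle_rel_def)
  qed
qed

end

end

theory Submission
  imports Defs "HOL-Library.Product_Plus"
begin

text \<open>
  A non-abelian 2-cocycle \<open>(\<chi>, \<psi>, F)\<close> is exactly the data of a non-abelian extension. On
  \<open>g \<times> h\<close> put the bracket with \<open>h\<close>-component \<open>\<chi> x y + \<psi> x k - \<psi> y h + [h, k]\<close> and the operator
  \<open>U (x, h) = (N x, S h + F x)\<close>. The cocycle identities say that this is a Nijenhuis Lie algebra
  (\<open>lie_algebra_ext\<close>, \<open>nijenhuis_lie_algebra_ext\<close>).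

  The deformation of any Nijenhuis Lie algebra is a Lie algebra, so \<open>U\<close> deforms the extension into
  another Lie algebra on \<open>g \<times> h\<close>. Writing out the deformed bracket shows that it is the extension
  bracket of the deformed algebras built from the deformed pair
  (\<open>deformed_ext_bracket\<close>); this is where the formulas for the deformed pair come from. Reading the
  Jacobi identity backwards (\<open>lie_cocycle_of_ext\<close>) gives the cocycle identities for the deformed
  pair, without any manipulation of the long formulas that define it.

  Equivalences have the same description: \<open>\<phi>\<close> is an equivalence precisely when the shear
  \<open>(x, h) \<mapsto> (x, h + \<phi> x)\<close> is an isomorphism of the extensions (\<open>lie_equiv_via_iff_shear\<close>) which
  moreover intertwines the operators. A map that respects brackets and operators respects the
  deformed brackets, which are composed of them. Hence the same \<open>\<phi>\<close> is an equivalence of the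
  deformed pairs, and the map descends to the quotients (\<open>ex1_quotient_map\<close>).
\<close>

section \<open>Extensions defined by cocycles\<close>

definition ext_scale ::
  "('k \<Rightarrow> 'g \<Rightarrow> 'g) \<Rightarrow> ('k \<Rightarrow> 'h \<Rightarrow> 'h) \<Rightarrow> 'k \<Rightarrow> 'g \<times> 'h \<Rightarrow> 'g \<times> 'h"
  where "ext_scale sg sh c = map_prod (sg c) (sh c)"

definition ext_bracket ::
  "('g \<Rightarrow> 'g \<Rightarrow> 'g) \<Rightarrow> ('h::ab_group_add \<Rightarrow> 'h \<Rightarrow> 'h) \<Rightarrow>
   ('g \<Rightarrow> 'g \<Rightarrow> 'h) \<times> ('g \<Rightarrow> 'h \<Rightarrow> 'h) \<Rightarrow> 'g \<times> 'h \<Rightarrow> 'g \<times> 'h \<Rightarrow> 'g \<times> 'h"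
  where "ext_bracket brg brh = (\<lambda>(\<chi>, \<psi>) (x, h) (y, k).
    (brg x y, \<chi> x y + \<psi> x k - \<psi> y h + brh h k))"

definition ext_op :: "('g \<Rightarrow> 'g) \<Rightarrow> ('h::ab_group_add \<Rightarrow> 'h) \<Rightarrow> ('g \<Rightarrow> 'h) \<Rightarrow> 'g \<times> 'h \<Rightarrow> 'g \<times> 'h"
  where "ext_op N S F = (\<lambda>(x, h). (N x, S h + F x))"

definition shear :: "('g \<Rightarrow> 'h::ab_group_add) \<Rightarrow> 'g \<times> 'h \<Rightarrow> 'g \<times> 'h"
  where "shear \<phi> = (\<lambda>(x, h). (x, h + \<phi> x))"

lemma ext_simps:
  "ext_scale sg sh c (x, h) = (sg c x, sh c h)"
  "ext_bracket brg brh (\<chi>, \<psi>) (x, h) (y, k) = (brg x y, \<chi> x y + \<psi> x k - \<psi> y h + brh h k)"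
  "ext_op N S F (x, h) = (N x, S h + F x)"
  "shear \<phi> (x, h) = (x, h + \<phi> x)"
  by (simp_all add: ext_scale_def ext_bracket_def ext_op_def shear_def)

lemma alternating_map_anticomm:
  assumes "alternating_map s1 s2 B"
  shows "B x y = - B y x"
proof -
  have B: "bilinear_map s1 s1 s2 B" and self: "B x x = 0" for x
    using assms by (auto simp: alternating_map_def)
  have "0 = B (x + y) (x + y)"
    by (rule self[symmetric])
  also have "\<dots> = B x x + B x y + (B y x + B y y)"
    by (simp only: bilinear_mapD[OF B] ac_simps)
  finally have "B x y + B y x = 0"
    by (simp add: self)
  then show ?thesis
    by (simp add: eq_neg_iff_add_eq_0)
qed

lemma vector_space_ext_scale:
  assumes "vector_space sg" "vector_space sh"
  shows "vector_space (ext_scale sg sh)"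
proof -
  interpret G: vector_space sg by fact
  interpret H: vector_space sh by fact
  show ?thesis
    by unfold_locales
      (auto simp: ext_simps G.scale_right_distrib H.scale_right_distrib
        G.scale_left_distrib H.scale_left_distrib)
qed

context
  fixes sg :: "'k::field \<Rightarrow> 'g::ab_group_add \<Rightarrow> 'g" and brg :: "'g \<Rightarrow> 'g \<Rightarrow> 'g"
    and sh :: "'k \<Rightarrow> 'h::ab_group_add \<Rightarrow> 'h" and brh :: "'h \<Rightarrow> 'h \<Rightarrow> 'h"
  assumes G: "lie_algebra sg brg" and H: "lie_algebra sh brh"
begin

interpretation G: lie_algebra sg brg by (rule G)
interpretation H: lie_algebra sh brh by (rule H)

text \<open>
  In the \<open>h\<close>-component of the Jacobi identity for \<open>(x, h)\<close>, \<open>(y, k)\<close>, \<open>(z, l)\<close>, the terms in \<open>x\<close>, \<open>y\<close>, \<open>z\<close>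
  alone form the cyclic identity for \<open>\<chi>\<close>, those with one entry from \<open>h\<close> cancel because \<open>\<chi>\<close> measures
  the failure of \<open>\<psi>\<close> to be a representation, those with two because every \<open>\<psi> x\<close> is a derivation, and those with three are the Jacobi identity of \<open>h\<close>.
\<close>

lemma lie_algebra_ext:
  assumes "lie_cocycle sg brg sh brh (\<chi>, \<psi>)"
  shows "lie_algebra (ext_scale sg sh) (ext_bracket brg brh (\<chi>, \<psi>))"
proof -
  let ?s = "ext_scale sg sh" and ?b = "ext_bracket brg brh (\<chi>, \<psi>)"
  have alt: "alternating_map sg sh \<chi>" and \<psi>: "bilinear_map sg sh sh \<psi>"
    and der: "\<psi> x (brh h k) = brh (\<psi> x h) k + brh h (\<psi> x k)"
    and curvature: "\<psi> x (\<psi> y h) - \<psi> y (\<psi> x h) - \<psi> (brg x y) h = brh (\<chi> x y) h"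
    and bianchi: "\<psi> x (\<chi> y z) + \<psi> y (\<chi> z x) + \<psi> z (\<chi> x y)
      - \<chi> (brg x y) z - \<chi> (brg y z) x - \<chi> (brg z x) y = 0" for x y z h k
    using assms by (auto simp: lie_cocycle_def lie_derivation_def)
  have \<chi>: "bilinear_map sg sg sh \<chi>" and \<chi>_self: "\<chi> x x = 0" for x
    using alt by (auto simp: alternating_map_def)
  note lin = bilinear_mapD[OF \<chi>] bilinear_mapD[OF \<psi>] G.bracket_simps H.bracket_simps
  have vs: "vector_space ?s"
    by (intro vector_space_ext_scale vs_gh[OF G H])
  have bil: "bilinear_map ?s ?s ?s ?b"
    unfolding bilinear_map_def
    by (auto intro!: linear_mapI vs
        simp: ext_simps lin algebra_simps)
  have jac: "?b p (?b q r) + ?b q (?b r p) + ?b r (?b p q) = 0" for p q r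
  proof -
    obtain x h y k z l where p: "p = (x, h)" "q = (y, k)" "r = (z, l)"
      by (cases p, cases q, cases r)
    have curvature': "\<psi> (brg x y) h = \<psi> x (\<psi> y h) - \<psi> y (\<psi> x h) - brh (\<chi> x y) h" for x y h
      by (simp flip: curvature)
    have bianchi': "\<chi> x (brg y z) + \<chi> y (brg z x) + \<chi> z (brg x y)
        = - (\<psi> x (\<chi> y z) + \<psi> y (\<chi> z x) + \<psi> z (\<chi> x y))"
      using bianchi[of x y z] alternating_map_anticomm[OF alt, of x "brg y z"]
        alternating_map_anticomm[OF alt, of y "brg z x"]
        alternating_map_anticomm[OF alt, of z "brg x y"]
      by (simp add: algebra_simps)
    have "snd (?b p (?b q r) + ?b q (?b r p) + ?b r (?b p q)) =
      (\<chi> x (brg y z) + \<chi> y (brg z x) + \<chi> z (brg x y))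
      + (\<psi> x (\<chi> y z) + \<psi> y (\<chi> z x) + \<psi> z (\<chi> x y))
      + (brh h (brh k l) + brh k (brh l h) + brh l (brh h k))"
      using H.bracket_anticomm[of "\<chi> y z" h] H.bracket_anticomm[of "\<chi> z x" k]
        H.bracket_anticomm[of "\<chi> x y" l]
        H.bracket_anticomm[of "\<psi> x k" l] H.bracket_anticomm[of "\<psi> x l" k]
        H.bracket_anticomm[of "\<psi> y h" l] H.bracket_anticomm[of "\<psi> y l" h]
        H.bracket_anticomm[of "\<psi> z h" k] H.bracket_anticomm[of "\<psi> z k" h]
      by (simp add: p ext_simps lin der curvature' algebra_simps)
    then show ?thesis
      by (simp add: prod_eq_iff bianchi' H.jacobi) (simp add: p ext_simps G.jacobi)
  qed
  from bil have "alternating_map ?s ?s ?b"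
    by (auto simp: alternating_map_def ext_simps \<chi>_self G.bracket_self H.bracket_self zero_prod_def)
  with vs jac show ?thesis
    by (intro lie_algebra.intro lie_algebra_axioms.intro)
qed

text \<open>
  The cocycle identities are the Jacobi identity of the extension evaluated on triples of
  elements of the two summands, sorted by the number of entries taken from \<open>h\<close>.
\<close>

lemma lie_cocycle_of_ext:
  assumes "lie_algebra (ext_scale sg sh) (ext_bracket brg brh (\<chi>, \<psi>))"
    and alt: "alternating_map sg sh \<chi>" and \<psi>: "bilinear_map sg sh sh \<psi>"
  shows "lie_cocycle sg brg sh brh (\<chi>, \<psi>)"
proof -
  let ?b = "ext_bracket brg brh (\<chi>, \<psi>)"
  interpret E: lie_algebra "ext_scale sg sh" ?b by fact
  have \<chi>: "bilinear_map sg sg sh \<chi>"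
    using alt by (auto simp: alternating_map_def)
  note lin = bilinear_mapD[OF \<chi>] bilinear_mapD[OF \<psi>] G.bracket_simps H.bracket_simps
  note jac = arg_cong[where f = snd, OF E.jacobi]
  have "\<psi> x (brh h k) = brh (\<psi> x h) k + brh h (\<psi> x k)" for x h k
    using jac[of "(x, 0)" "(0, h)" "(0, k)"] H.bracket_anticomm[of k "\<psi> x h"]
    by (simp add: ext_simps lin algebra_simps)
  moreover have "\<psi> x (\<psi> y h) - \<psi> y (\<psi> x h) - \<psi> (brg x y) h = brh (\<chi> x y) h" for x y h
    using jac[of "(x, 0)" "(y, 0)" "(0, h)"] H.bracket_anticomm[of h "\<chi> x y"]
    by (simp add: ext_simps lin algebra_simps)
  moreover have "\<psi> x (\<chi> y z) + \<psi> y (\<chi> z x) + \<psi> z (\<chi> x y)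
      - \<chi> (brg x y) z - \<chi> (brg y z) x - \<chi> (brg z x) y = 0" for x y z
    using jac[of "(x, 0)" "(y, 0)" "(z, 0)"] alternating_map_anticomm[OF alt, of x "brg y z"]
      alternating_map_anticomm[OF alt, of y "brg z x"]
      alternating_map_anticomm[OF alt, of z "brg x y"]
    by (simp add: ext_simps lin algebra_simps)
  ultimately show ?thesis
    using alt \<psi> by (auto simp: lie_cocycle_def lie_derivation_def bilinear_map_def)
qed

text \<open>
  The pair \<open>(x, 0)\<close>, \<open>(0, h)\<close> detects the condition on \<open>\<psi>\<close> and the pair \<open>(x, 0)\<close>, \<open>(y, 0)\<close> the condition
  on \<open>\<chi>\<close>. Stating this as an equivalence makes it possible to pass from \<open>\<phi>\<close> to a morphism, deform
  both sides, and return to a condition on \<open>\<phi>\<close>.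
\<close>

lemma lie_equiv_via_iff_shear:
  assumes \<psi>: "bilinear_map sg sh sh \<psi>" and \<psi>': "bilinear_map sg sh sh \<psi>'"
    and alt: "alternating_map sg sh \<chi>" "alternating_map sg sh \<chi>'"
  shows "lie_equiv_via sg brg sh brh \<phi> (\<chi>, \<psi>) (\<chi>', \<psi>') \<longleftrightarrow>
    Vector_Spaces.linear sg sh \<phi> \<and>
    (\<forall>p q. shear \<phi> (ext_bracket brg brh (\<chi>, \<psi>) p q) =
      ext_bracket brg brh (\<chi>', \<psi>') (shear \<phi> p) (shear \<phi> q))"
    (is "?equiv \<longleftrightarrow> ?lin \<and> ?hom")
proof (intro iffI conjI)
  assume equiv: ?equiv
  then show ?lin by (simp add: lie_equiv_via_def)
  have a: "\<psi> x h = \<psi>' x h + brh (\<phi> x) h"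
    and b: "\<chi> x y = \<chi>' x y + (\<psi>' x (\<phi> y) - \<psi>' y (\<phi> x) - \<phi> (brg x y) + brh (\<phi> x) (\<phi> y))"
    for x y h
    using equiv by (auto simp: lie_equiv_via_def algebra_simps)
  show ?hom
  proof (intro allI)
    fix p q :: "'g \<times> 'h"
    obtain x h y k where p: "p = (x, h)" "q = (y, k)"
      by (cases p, cases q)
    show "shear \<phi> (ext_bracket brg brh (\<chi>, \<psi>) p q) =
        ext_bracket brg brh (\<chi>', \<psi>') (shear \<phi> p) (shear \<phi> q)"
      using H.bracket_anticomm[of "\<phi> y" h]
      by (simp add: p ext_simps a b bilinear_mapD[OF \<psi>'] H.bracket_simps algebra_simps)
  qed
next
  assume "?lin \<and> ?hom"
  then have lin: ?lin and hom: "shear \<phi> (ext_bracket brg brh (\<chi>, \<psi>) p q) =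
      ext_bracket brg brh (\<chi>', \<psi>') (shear \<phi> p) (shear \<phi> q)" for p q
    by blast+
  have \<chi>: "bilinear_map sg sg sh \<chi>" "bilinear_map sg sg sh \<chi>'"
    using alt by (auto simp: alternating_map_def)
  note lins = bilinear_mapD[OF \<psi>] bilinear_mapD[OF \<psi>'] bilinear_mapD[OF \<chi>(1)]
    bilinear_mapD[OF \<chi>(2)] G.bracket_simps H.bracket_simps linear_mapD[OF lin]
  have "\<psi> x h - \<psi>' x h = brh (\<phi> x) h" for x h
    using hom[of "(x, 0)" "(0, h)"] by (simp add: ext_simps lins)
  moreover have "\<chi> x y - \<chi>' x y =
      \<psi>' x (\<phi> y) - \<psi>' y (\<phi> x) - \<phi> (brg x y) + brh (\<phi> x) (\<phi> y)" for x y
    using hom[of "(x, 0)" "(y, 0)"] by (simp add: ext_simps lins algebra_simps)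
  ultimately show ?equiv
    using lin by (simp add: lie_equiv_via_def)
qed

end

section \<open>Deforming an extension\<close>

context
  fixes sg :: "'k::field \<Rightarrow> 'g::ab_group_add \<Rightarrow> 'g" and brg :: "'g \<Rightarrow> 'g \<Rightarrow> 'g" and N :: "'g \<Rightarrow> 'g"
    and sh :: "'k \<Rightarrow> 'h::ab_group_add \<Rightarrow> 'h" and brh :: "'h \<Rightarrow> 'h \<Rightarrow> 'h" and S :: "'h \<Rightarrow> 'h"
  assumes GN: "nijenhuis_lie_algebra sg brg N" and HS: "nijenhuis_lie_algebra sh brh S"
begin

interpretation G: nijenhuis_lie_algebra sg brg N by (rule GN)
interpretation H: nijenhuis_lie_algebra sh brh S by (rule HS)

text \<open>
  The two cocycle identities involving \<open>F\<close> are the Nijenhuis condition on an element of \<open>g\<close> and one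
  of \<open>h\<close> (the identity for \<open>\<psi> (N x) (S h)\<close>) and on two elements of \<open>g\<close> (the one for
  \<open>\<chi> (N x) (N y)\<close>); on two elements of \<open>h\<close> it is the condition for \<open>S\<close>.
\<close>

lemma nijenhuis_lie_algebra_ext:
  assumes "nij_cocycle sg brg N sh brh S (\<chi>, \<psi>, F)"
  shows "nijenhuis_lie_algebra (ext_scale sg sh) (ext_bracket brg brh (\<chi>, \<psi>)) (ext_op N S F)"
proof -
  let ?b = "ext_bracket brg brh (\<chi>, \<psi>)" and ?U = "ext_op N S F"
  have coc: "lie_cocycle sg brg sh brh (\<chi>, \<psi>)" and F: "Vector_Spaces.linear sg sh F"
    and twist_\<psi>: "\<psi> (N x) (S h) =
      S (\<psi> (N x) h + \<psi> x (S h) - S (\<psi> x h)) + S (brh (F x) h) - brh (F x) (S h)"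
    and twist_F: "\<chi> (N x) (N y) - S (\<chi> (N x) y + \<chi> x (N y) - S (\<chi> x y))
      - F (brg (N x) y + brg x (N y) - N (brg x y))
      + \<psi> (N x) (F y) - \<psi> (N y) (F x)
      - S (\<psi> x (F y) - \<psi> y (F x) - F (brg x y)) + brh (F x) (F y) = 0" for x y h
    using assms by (auto simp: nij_cocycle_def)
  interpret E: lie_algebra "ext_scale sg sh" ?b
    by (rule lie_algebra_ext[OF G.lie_algebra_axioms H.lie_algebra_axioms coc])
  have \<chi>: "bilinear_map sg sg sh \<chi>" and \<psi>: "bilinear_map sg sh sh \<psi>"
    using coc by (auto simp: lie_cocycle_def alternating_map_def)
  note lin = bilinear_mapD[OF \<chi>] bilinear_mapD[OF \<psi>] G.bracket_simps H.bracket_simps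
    linear_mapD[OF F] G.N_simps H.N_simps
  have "Vector_Spaces.linear (ext_scale sg sh) (ext_scale sg sh) ?U"
    by (intro linear_mapI vector_space_ext_scale G.vector_space_scale H.vector_space_scale)
      (auto simp: ext_simps lin H.scale_right_distrib algebra_simps)
  moreover have "?b (?U p) (?U q) = ?U (?b (?U p) q + ?b p (?U q) - ?U (?b p q))" for p q
  proof -
    obtain x h y k where p: "p = (x, h)" "q = (y, k)"
      by (cases p, cases q)
    have twist_F': "\<chi> (N x) (N y) = S (\<chi> (N x) y + \<chi> x (N y) - S (\<chi> x y))
      + F (brg (N x) y + brg x (N y) - N (brg x y))
      - \<psi> (N x) (F y) + \<psi> (N y) (F x)
      + S (\<psi> x (F y) - \<psi> y (F x) - F (brg x y)) - brh (F x) (F y)"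
      using twist_F[of x y] by (simp add: algebra_simps)
    show ?thesis
      using H.bracket_anticomm[of "F y" h] H.bracket_anticomm[of "F y" "S h"]
      by (simp add: p ext_simps lin twist_\<psi> twist_F' G.nijenhuis H.nijenhuis algebra_simps)
  qed
  ultimately show ?thesis
    by (intro nijenhuis_lie_algebra.intro nijenhuis_lie_algebra_axioms.intro E.lie_algebra_axioms)
qed

text \<open>
  Deforming commutes with forming the extension. The terms of the deformed pair containing \<open>F\<close> come from
  the off-diagonal part of \<open>ext_op N S F\<close>.
\<close>

lemma deformed_ext_bracket:
  assumes "nij_cocycle sg brg N sh brh S (\<chi>, \<psi>, F)"
  shows "deformed_bracket (ext_bracket brg brh (\<chi>, \<psi>)) (ext_op N S F) =
    ext_bracket (deformed_bracket brg N) (deformed_bracket brh S)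
      (deformed_cocycle brg N brh S (\<chi>, \<psi>, F))"
proof (intro ext)
  fix p q :: "'g \<times> 'h"
  obtain x h y k where p: "p = (x, h)" "q = (y, k)"
    by (cases p, cases q)
  have \<psi>: "bilinear_map sg sh sh \<psi>"
    using assms by (auto simp: nij_cocycle_def lie_cocycle_def)
  show "deformed_bracket (ext_bracket brg brh (\<chi>, \<psi>)) (ext_op N S F) p q =
    ext_bracket (deformed_bracket brg N) (deformed_bracket brh S)
      (deformed_cocycle brg N brh S (\<chi>, \<psi>, F)) p q"
    using H.bracket_anticomm[of "F y" h]
    by (simp add: p deformed_bracket_def deformed_cocycle_def ext_simps
        bilinear_mapD[OF \<psi>] H.bracket_simps H.N_simps algebra_simps)
qed

text \<open>
  The multilinearity that \<open>lie_cocycle_of_ext\<close> presupposes, so that the entries \<open>0\<close> can be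
  substituted there.
\<close>

lemma deformed_cocycle_maps:
  assumes "nij_cocycle sg brg N sh brh S (\<chi>, \<psi>, F)"
    and "deformed_cocycle brg N brh S (\<chi>, \<psi>, F) = (\<chi>d, \<psi>d)"
  shows "alternating_map sg sh \<chi>d" "bilinear_map sg sh sh \<psi>d"
proof -
  have alt: "alternating_map sg sh \<chi>" and \<psi>: "bilinear_map sg sh sh \<psi>"
    and F: "Vector_Spaces.linear sg sh F"
    using assms by (auto simp: nij_cocycle_def lie_cocycle_def)
  have \<chi>: "bilinear_map sg sg sh \<chi>" and \<chi>_self: "\<chi> x x = 0" for x
    using alt by (auto simp: alternating_map_def)
  have d: "\<chi>d = (\<lambda>x y. \<chi> (N x) y + \<chi> x (N y) - S (\<chi> x y) + \<psi> x (F y) - \<psi> y (F x) - F (brg x y))"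
    "\<psi>d = (\<lambda>x h. \<psi> (N x) h + \<psi> x (S h) - S (\<psi> x h) + brh (F x) h)"
    using assms(2) by (auto simp: deformed_cocycle_def)
  note lin = bilinear_mapD[OF \<chi>] bilinear_mapD[OF \<psi>] G.bracket_simps H.bracket_simps
    linear_mapD[OF F] G.N_simps H.N_simps H.scale_right_distrib
    H.scale_right_diff_distrib
  show "bilinear_map sg sh sh \<psi>d"
    unfolding bilinear_map_def d
    by (auto intro!: linear_mapI G.vector_space_scale H.vector_space_scale
        simp: lin algebra_simps)
  have "bilinear_map sg sg sh \<chi>d"
    unfolding bilinear_map_def d
    by (auto intro!: linear_mapI G.vector_space_scale H.vector_space_scale
        simp: lin algebra_simps)
  moreover have "\<chi>d x x = 0" for x
    using alternating_map_anticomm[OF alt, of "N x" x]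
    by (simp add: d \<chi>_self G.bracket_self lin)
  ultimately show "alternating_map sg sh \<chi>d"
    by (simp add: alternating_map_def)
qed

theorem lie_cocycle_deformed_cocycle:
  assumes "nij_cocycle sg brg N sh brh S (\<chi>, \<psi>, F)"
  shows "lie_cocycle sg (deformed_bracket brg N) sh (deformed_bracket brh S)
    (deformed_cocycle brg N brh S (\<chi>, \<psi>, F))"
proof -
  obtain \<chi>d \<psi>d where d: "deformed_cocycle brg N brh S (\<chi>, \<psi>, F) = (\<chi>d, \<psi>d)"
    by fastforce
  interpret E: nijenhuis_lie_algebra "ext_scale sg sh" "ext_bracket brg brh (\<chi>, \<psi>)" "ext_op N S F"
    by (rule nijenhuis_lie_algebra_ext[OF assms])
  have "lie_algebra (ext_scale sg sh)
      (ext_bracket (deformed_bracket brg N) (deformed_bracket brh S) (\<chi>d, \<psi>d))"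
    using E.lie_algebra_deformed by (simp add: deformed_ext_bracket[OF assms] d)
  then show ?thesis
    unfolding d
    by (rule lie_cocycle_of_ext[OF G.lie_algebra_deformed H.lie_algebra_deformed
          _ deformed_cocycle_maps[OF assms d]])
qed

theorem lie_equiv_via_deformed_cocycle:
  assumes c: "nij_cocycle sg brg N sh brh S (\<chi>, \<psi>, F)"
    and c': "nij_cocycle sg brg N sh brh S (\<chi>', \<psi>', F')"
    and equiv: "nij_equiv_via sg brg N sh brh S \<phi> (\<chi>, \<psi>, F) (\<chi>', \<psi>', F')"
  shows "lie_equiv_via sg (deformed_bracket brg N) sh (deformed_bracket brh S) \<phi>
    (deformed_cocycle brg N brh S (\<chi>, \<psi>, F)) (deformed_cocycle brg N brh S (\<chi>', \<psi>', F'))"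
proof -
  obtain \<chi>d \<psi>d where d: "deformed_cocycle brg N brh S (\<chi>, \<psi>, F) = (\<chi>d, \<psi>d)"
    by fastforce
  obtain \<chi>d' \<psi>d' where d': "deformed_cocycle brg N brh S (\<chi>', \<psi>', F') = (\<chi>d', \<psi>d')"
    by fastforce
  let ?T = "shear \<phi>"
  let ?b = "ext_bracket brg brh (\<chi>, \<psi>)" and ?b' = "ext_bracket brg brh (\<chi>', \<psi>')"
  let ?U = "ext_op N S F" and ?U' = "ext_op N S F'"
  have "bilinear_map sg sh sh \<psi>" "bilinear_map sg sh sh \<psi>'"
    "alternating_map sg sh \<chi>" "alternating_map sg sh \<chi>'"
    using c c' by (auto simp: nij_cocycle_def lie_cocycle_def)
  from lie_equiv_via_iff_shear[OF G.lie_algebra_axioms H.lie_algebra_axioms this, of \<phi>] equiv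
  have lin: "Vector_Spaces.linear sg sh \<phi>" and hom: "?T (?b p q) = ?b' (?T p) (?T q)"
    and F: "F x - F' x = S (\<phi> x) - \<phi> (N x)" for p q x
    by (auto simp: nij_equiv_via_def simp del: split_paired_All)
  have T_diff: "?T (p - q) = ?T p - ?T q" and T_add: "?T (p + q) = ?T p + ?T q" for p q
    by (cases p; cases q; simp add: ext_simps linear_mapD[OF lin])+
  have U: "?T (?U p) = ?U' (?T p)" for p
  proof (cases p)
    case (Pair x h)
    then show ?thesis
      using F[of x] by (simp add: ext_simps H.N_simps algebra_simps)
  qed
  have "?T (deformed_bracket ?b ?U p q) = deformed_bracket ?b' ?U' (?T p) (?T q)" for p q
    by (simp add: deformed_bracket_def T_diff T_add hom U)
  then show ?thesis
    unfolding d d'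
    by (subst lie_equiv_via_iff_shear[OF G.lie_algebra_deformed H.lie_algebra_deformed])
      (use lin deformed_cocycle_maps[OF c d] deformed_cocycle_maps[OF c' d'] in
        \<open>simp_all add: deformed_ext_bracket[OF c] deformed_ext_bracket[OF c'] d d'\<close>)
qed

end

section \<open>Passing to equivalence classes\<close>

text \<open>
  The value outside \<open>A // r\<close> is fixed by extensionality of \<open>\<rightarrow>\<^sub>E\<close>, so uniqueness holds among all functions.
\<close>

lemma ex1_quotient_map:
  assumes r: "equiv A r" and s: "equiv B s"
    and f: "\<And>a a'. (a, a') \<in> r \<Longrightarrow> (f a, f a') \<in> s"
  shows "\<exists>!\<Phi>. \<Phi> \<in> A // r \<rightarrow>\<^sub>E B // s \<and> (\<forall>a\<in>A. \<Phi> (r `` {a}) = s `` {f a})"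
proof (rule ex1I)
  \<comment> \<open>Saturating the image of a whole class avoids a choice of representative.\<close>
  let ?\<Phi> = "\<lambda>X\<in>A // r. s `` (f ` X)"
  have f_in: "f a \<in> B" if "a \<in> A" for a
    using f[of a a] that r s by (auto simp: equiv_def refl_on_def)
  have val: "s `` (f ` (r `` {a})) = s `` {f a}" if "a \<in> A" for a
  proof
    show "s `` (f ` (r `` {a})) \<subseteq> s `` {f a}"
      using f s by (auto simp: equiv_def dest: transD)
    show "s `` {f a} \<subseteq> s `` (f ` (r `` {a}))"
      using equiv_class_self[OF r that] by auto
  qed
  show "?\<Phi> \<in> A // r \<rightarrow>\<^sub>E B // s \<and> (\<forall>a\<in>A. ?\<Phi> (r `` {a}) = s `` {f a})"
    by (auto simp: val quotientI f_in elim!: quotientE)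
  show "\<Psi> = ?\<Phi>" if "\<Psi> \<in> A // r \<rightarrow>\<^sub>E B // s \<and> (\<forall>a\<in>A. \<Psi> (r `` {a}) = s `` {f a})" for \<Psi>
  proof
    fix X
    show "\<Psi> X = ?\<Phi> X"
    proof (cases "X \<in> A // r")
      case True
      then obtain a where "a \<in> A" "X = r `` {a}"
        by (rule quotientE)
      with that True show ?thesis
        by (simp add: val)
    next
      case False
      have "\<Psi> X = undefined"
        by (rule PiE_arb[OF _ False]) (use that in blast)
      then show ?thesis
        by (simp only: restrict_apply False if_False)
    qed
  qed
qed

theorem mainTheorem2:
  fixes sg :: "'k::field \<Rightarrow> 'g::ab_group_add \<Rightarrow> 'g" and brg :: "'g \<Rightarrow> 'g \<Rightarrow> 'g" and N :: "'g \<Rightarrow> 'g"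
    and sh :: "'k \<Rightarrow> 'h::ab_group_add \<Rightarrow> 'h" and brh :: "'h \<Rightarrow> 'h \<Rightarrow> 'h" and S :: "'h \<Rightarrow> 'h"
  assumes "nijenhuis_lie_algebra sg brg N"
    and "nijenhuis_lie_algebra sh brh S"
  shows
    "(\<forall>\<chi> \<psi> F. (\<chi>, \<psi>, F) \<in> nij_cocycles sg brg N sh brh S \<longrightarrow>
        deformed_cocycle brg N brh S (\<chi>, \<psi>, F)
          \<in> lie_cocycles sg (deformed_bracket brg N) sh (deformed_bracket brh S))
     \<and> (\<forall>\<chi> \<psi> F \<chi>' \<psi>' F'.
        ((\<chi>, \<psi>, F), (\<chi>', \<psi>', F')) \<in> nij_cocycle_rel sg brg N sh brh S \<longrightarrow>
        (deformed_cocycle brg N brh S (\<chi>, \<psi>, F), deformed_cocycle brg N brh S (\<chi>', \<psi>', F'))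
          \<in> lie_cocycle_rel sg (deformed_bracket brg N) sh (deformed_bracket brh S))
     \<and> (\<exists>!\<Phi>. \<Phi> \<in> nij_H2_nab sg brg N sh brh S
              \<rightarrow>\<^sub>E lie_H2_nab sg (deformed_bracket brg N) sh (deformed_bracket brh S)
          \<and> (\<forall>\<chi> \<psi> F. (\<chi>, \<psi>, F) \<in> nij_cocycles sg brg N sh brh S \<longrightarrow>
              \<Phi> (nij_cocycle_rel sg brg N sh brh S `` {(\<chi>, \<psi>, F)})
              = lie_cocycle_rel sg (deformed_bracket brg N) sh (deformed_bracket brh S)
                  `` {deformed_cocycle brg N brh S (\<chi>, \<psi>, F)}))"
proof -
  interpret G: nijenhuis_lie_algebra sg brg N by fact
  interpret H: nijenhuis_lie_algebra sh brh S by fact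
  let ?Z = "nij_cocycles sg brg N sh brh S" and ?R = "nij_cocycle_rel sg brg N sh brh S"
  let ?Zd = "lie_cocycles sg (deformed_bracket brg N) sh (deformed_bracket brh S)"
  let ?Rd = "lie_cocycle_rel sg (deformed_bracket brg N) sh (deformed_bracket brh S)"
  let ?d = "deformed_cocycle brg N brh S"
  have cocycle: "?d c \<in> ?Zd" if "c \<in> ?Z" for c
    using lie_cocycle_deformed_cocycle[OF assms] that
    by (cases c) (simp add: nij_cocycles_def lie_cocycles_def)
  have rel: "(?d c, ?d c') \<in> ?Rd" if R: "(c, c') \<in> ?R" for c c'
  proof -
    from R obtain \<phi> where Z: "c \<in> ?Z" "c' \<in> ?Z" and "nij_equiv_via sg brg N sh brh S \<phi> c c'"
      by (auto simp: nij_cocycle_rel_def)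
    then have "lie_equiv_via sg (deformed_bracket brg N) sh (deformed_bracket brh S) \<phi> (?d c) (?d c')"
      using lie_equiv_via_deformed_cocycle[OF assms]
      by (cases c; cases c') (simp add: nij_cocycles_def)
    with cocycle Z show ?thesis
      by (auto simp: lie_cocycle_rel_def)
  qed
  have "\<exists>!\<Phi>. \<Phi> \<in> ?Z // ?R \<rightarrow>\<^sub>E ?Zd // ?Rd \<and> (\<forall>c\<in>?Z. \<Phi> (?R `` {c}) = ?Rd `` {?d c})"
    by (intro ex1_quotient_map rel
        equiv_nij_cocycle_rel G.lie_algebra_axioms H.lie_algebra_axioms G.linear_N H.linear_N
        equiv_lie_cocycle_rel G.lie_algebra_deformed H.lie_algebra_deformed)
  then have "\<exists>!\<Phi>. \<Phi> \<in> ?Z // ?R \<rightarrow>\<^sub>E ?Zd // ?Rd \<and>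
      (\<forall>\<chi> \<psi> F. (\<chi>, \<psi>, F) \<in> ?Z \<longrightarrow> \<Phi> (?R `` {(\<chi>, \<psi>, F)}) = ?Rd `` {?d (\<chi>, \<psi>, F)})"
    by (simp only: Ball_def split_paired_All)
  then show ?thesis
    unfolding nij_H2_nab_def lie_H2_nab_def using cocycle rel by blast
qed

end
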